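(* Let $m\geq 2$ be an integer, let $\ell_1(x,y),\ldots,\ell_m(x,y)$ be $m$ pairwise distinct (i.e. pairwise non-proportional) linear forms in $x,y$ with complex coefficients, let $k_1,\ldots,k_m\geq 1$ be integers and let $d=\sum_{j=1}^m k_j$. Consider the curve in $\mathbb{P}^2$ $$C:\ F=\prod_{j=1}^m\ell_j(x,y)^{k_j}-z^d=0$$ and the lines $L_j:\ell_j(x,y)=0$, $j=1,\ldots,m$. Then the curve $$C'=C\cup\bigcup_{j=1}^m L_j:\quad F'=F\cdot\prod_{j=1}^m\ell_j=0$$ of degree $d+m$ is free with exponents $(m-1,d)$. Moreover, if $L:z=0$ (the line passing through all the points $p_j=L_j\cap\{z=0\}$ of $C$), then the curve $$C''=C'\cup L:\quad F''=zF\cdot\prod_{j=1}^m\ell_j=0$$ of degree $d+m+1$ is free with exponents $(m-1,d+1)$.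
   Context: Let $S=\mathbb{C}[x,y,z]$. For a reduced plane curve $G=0$ in $\mathbb{P}^2$ with $G\in S$ homogeneous, let $D_0(G)=\{a\partial_x+b\partial_y+c\partial_z : a,b,c\in S,\ aG_x+bG_y+cG_z=0\}$, a graded $S$-module of rank 2 (a derivation has degree $r$ if $a,b,c$ are homogeneous of degree $r$). The curve $G=0$ is free if $D_0(G)$ is a free graded $S$-module; its exponents $(d_1,d_2)$ are then the degrees of the elements of a homogeneous basis of $D_0(G)$. *)

theory Defs
  imports "HOL-Computational_Algebra.Computational_Algebra" "HOL-Library.Product_Plus"
begin

text \<open>
  The ring \<open>S = \<complex>[x,y,z]\<close> is modelled as \<open>\<complex>[x][y][z]\<close>: the outermost polynomial
  variable is \<open>z\<close>, the innermost one is \<open>x\<close>. Hence the coefficient of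
  \<open>x^i y^j z^k\<close> in \<open>p\<close> is \<open>coeff (coeff (coeff p k) j) i\<close>.
\<close>

type_synonym poly3 = "complex poly poly poly"

definition const3 :: "complex \<Rightarrow> poly3" where
  "const3 c = [:[:[:c:]:]:]"

definition X :: poly3 where "X = [:[:[:0, 1:]:]:]"
definition Y :: poly3 where "Y = [:[:0, 1:]:]"
definition Z :: poly3 where "Z = [:0, 1:]"

definition partial_x :: "poly3 \<Rightarrow> poly3" where
  "partial_x = map_poly (map_poly pderiv)"

definition partial_y :: "poly3 \<Rightarrow> poly3" where
  "partial_y = map_poly pderiv"

definition partial_z :: "poly3 \<Rightarrow> poly3" where
  "partial_z = pderiv"

definition homogeneous :: "nat \<Rightarrow> poly3 \<Rightarrow> bool" where
  "homogeneous n p \<longleftrightarrow>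
     (\<forall>i j k. coeff (coeff (coeff p k) j) i \<noteq> 0 \<longrightarrow> i + j + k = n)"

definition linear_form_xy :: "poly3 \<Rightarrow> bool" where
  "linear_form_xy l \<longleftrightarrow> l \<noteq> 0 \<and> (\<exists>a b. l = const3 a * X + const3 b * Y)"

definition proportional :: "poly3 \<Rightarrow> poly3 \<Rightarrow> bool" where
  "proportional p q \<longleftrightarrow> (\<exists>c. c \<noteq> 0 \<and> p = const3 c * q)"

definition reduced_plane_curve :: "nat \<Rightarrow> poly3 \<Rightarrow> bool" where
  "reduced_plane_curve n G \<longleftrightarrow> 1 \<le> n \<and> G \<noteq> 0 \<and> homogeneous n G \<and> squarefree G"

text \<open>
  The derivation \<open>a \<partial>\<^sub>x + b \<partial>\<^sub>y + c \<partial>\<^sub>z\<close> of \<open>S\<close> is represented by its coefficient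
  triple \<open>(a, b, c)\<close>.
\<close>

type_synonym derivation = "poly3 \<times> poly3 \<times> poly3"

definition scale_deriv :: "poly3 \<Rightarrow> derivation \<Rightarrow> derivation" where
  "scale_deriv s = (\<lambda>(a, b, c). (s * a, s * b, s * c))"

interpretation derivations: module scale_deriv
  by standard (auto simp: scale_deriv_def algebra_simps)

definition homogeneous_deriv :: "nat \<Rightarrow> derivation \<Rightarrow> bool" where
  "homogeneous_deriv r = (\<lambda>(a, b, c). homogeneous r a \<and> homogeneous r b \<and> homogeneous r c)"

definition D0 :: "poly3 \<Rightarrow> derivation set" where
  "D0 G = {(a, b, c). a * partial_x G + b * partial_y G + c * partial_z G = 0}"

definition homogeneous_basis :: "poly3 \<Rightarrow> derivation set \<Rightarrow> bool" where
  "homogeneous_basis G B \<longleftrightarrow>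
     (\<forall>\<theta>\<in>B. \<exists>r. homogeneous_deriv r \<theta>) \<and>
     derivations.independent B \<and> derivations.span B = D0 G"

text \<open>A graded module is graded free iff it has a basis of homogeneous elements.\<close>

definition free_curve :: "poly3 \<Rightarrow> bool" where
  "free_curve G \<longleftrightarrow> (\<exists>n. reduced_plane_curve n G) \<and> (\<exists>B. homogeneous_basis G B)"

definition has_exponents :: "poly3 \<Rightarrow> nat \<Rightarrow> nat \<Rightarrow> bool" where
  "has_exponents G d1 d2 \<longleftrightarrow>
     (\<exists>\<theta>1 \<theta>2. \<theta>1 \<noteq> \<theta>2 \<and> homogeneous_basis G {\<theta>1, \<theta>2} \<and>
        homogeneous_deriv d1 \<theta>1 \<and> homogeneous_deriv d2 \<theta>2)"

end

theory Submission
  imports Defs "HOL-Computational_Algebra.Field_as_Ring"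
begin

text \<open>
  Let \<open>Q\<close> be the product of the \<open>\<ell>\<^sub>j\<close>, and let \<open>(a, b, c)\<close> kill \<open>G = z^e F Q\<close>. Since \<open>\<ell>\<^sub>j\<close> is
  coprime to \<open>G / \<ell>\<^sub>j\<close>, it divides its own image under the derivation, hence divides \<open>x b - y a\<close>;
  so \<open>Q\<close> divides \<open>x b - y a\<close>. There is an explicit \<open>\<theta>\<^sub>1\<close> killing \<open>G\<close>, a weighted sum of the
  Hamiltonian fields of the \<open>\<ell>\<^sub>j\<close> times \<open>Q / \<ell>\<^sub>j\<close>, for which \<open>x b - y a\<close> is a nonzero constant times
  \<open>Q\<close>. Subtracting a multiple of it leaves a derivation \<open>(\<alpha> x, \<alpha> y, c)\<close> killing \<open>G\<close>, that is, a
  solution of \<open>\<alpha> U + c V = 0\<close> with \<open>U\<close>, \<open>V\<close> coprime, and these are the multiples of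
  \<open>\<theta>\<^sub>2 = (V x, V y, -U)\<close>.
\<close>

subsection \<open>Derivations of polynomial rings\<close>

text \<open>One framework for the three partial derivatives and for every operator
  \<open>apply_deriv \<theta>\<close>.\<close>

locale derivation_op =
  fixes D :: "'a::comm_ring_1 \<Rightarrow> 'a"
  assumes add: "D (f + g) = D f + D g"
    and mult: "D (f * g) = D f * g + f * D g"
begin

lemma zero [simp]: "D 0 = 0"
  using add[of 0 0] by simp

lemma one [simp]: "D 1 = 0"
  using mult[of 1 1] by simp

lemma minus: "D (- f) = - D f"
  using add[of f "- f"] by (simp add: eq_neg_iff_add_eq_0 add.commute)

lemma diff: "D (f - g) = D f - D g"
  using add[of f "- g"] by (simp add: minus)

lemma power_eigen:
  assumes "D f = g * f"
  shows "D (f ^ n) = of_nat n * g * f ^ n"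
  by (induction n) (simp_all add: mult assms algebra_simps)

text \<open>Logarithmic derivatives add over a product. This reads off the effect of a derivation on
  \<open>P\<close> and \<open>Q\<close> from its effect on each line.\<close>

lemma prod_eigen:
  assumes "finite I" "\<And>i. i \<in> I \<Longrightarrow> D (f i) = g i * f i"
  shows "D (\<Prod>i\<in>I. f i) = (\<Sum>i\<in>I. g i) * (\<Prod>i\<in>I. f i)"
  using assms by (induction I rule: finite_induct) (simp_all add: mult algebra_simps)

text \<open>By the Leibniz rule one factor \<open>p\<close> survives in every term. Serves as the
  derivative test for squarefreeness.\<close>

lemma square_dvd_imp_dvd:
  assumes "p\<^sup>2 dvd f"
  shows "p dvd D f"
proof -
  obtain h where "f = p * (p * h)"
    using assms by (auto simp: power2_eq_square mult.assoc)
  then show ?thesis by (simp add: mult)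
qed

text \<open>Acting coefficientwise carries a derivation up one layer of the tower of polynomial
  rings; the partials in the inner variables arise this way.\<close>

lemma map_poly: "derivation_op (map_poly D)"
proof
  fix f g :: "'a poly"
  show "map_poly D (f + g) = map_poly D f + map_poly D g"
    by (simp add: poly_eq_iff coeff_map_poly add)
  have sum: "D (sum h A) = (\<Sum>x\<in>A. D (h x))" for h :: "nat \<Rightarrow> 'a" and A
    by (induction A rule: infinite_finite_induct) (simp_all add: add)
  show "map_poly D (f * g) = map_poly D f * g + f * map_poly D g"
    by (simp add: poly_eq_iff coeff_map_poly coeff_mult sum mult sum.distrib)
qed

end

lemma derivation_op_pderiv: "derivation_op (pderiv :: 'a::idom poly \<Rightarrow> 'a poly)"
  by standard (simp_all add: pderiv_add pderiv_mult)

interpretation px: derivation_op partial_x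
  unfolding partial_x_def by (intro derivation_op.map_poly derivation_op_pderiv)

interpretation py: derivation_op partial_y
  unfolding partial_y_def by (intro derivation_op.map_poly derivation_op_pderiv)

interpretation pz: derivation_op partial_z
  unfolding partial_z_def by (rule derivation_op_pderiv)

definition apply_deriv :: "derivation \<Rightarrow> poly3 \<Rightarrow> poly3" where
  "apply_deriv = (\<lambda>(a, b, c) f. a * partial_x f + b * partial_y f + c * partial_z f)"

lemma D0_iff: "\<theta> \<in> D0 G \<longleftrightarrow> apply_deriv \<theta> G = 0"
  by (auto simp: D0_def apply_deriv_def)

interpretation ad: derivation_op "apply_deriv \<theta>" for \<theta>
  by standard (auto simp: apply_deriv_def px.add py.add pz.add px.mult py.mult pz.mult
      algebra_simps split: prod.split)

lemma partial_const3 [simp]: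
  "partial_x (const3 c) = 0" "partial_y (const3 c) = 0" "partial_z (const3 c) = 0"
  by (simp_all add: partial_x_def partial_y_def partial_z_def const3_def map_poly_pCons pderiv_pCons)

lemma partial_X [simp]: "partial_x X = 1" "partial_y X = 0" "partial_z X = 0"
  by (simp_all add: partial_x_def partial_y_def partial_z_def X_def map_poly_pCons pderiv_pCons one_pCons)

lemma partial_Y [simp]: "partial_x Y = 0" "partial_y Y = 1" "partial_z Y = 0"
  by (simp_all add: partial_x_def partial_y_def partial_z_def Y_def map_poly_pCons pderiv_pCons one_pCons)

lemma partial_Z [simp]: "partial_x Z = 0" "partial_y Z = 0" "partial_z Z = 1"
  by (simp_all add: partial_x_def partial_y_def partial_z_def Z_def map_poly_pCons pderiv_pCons one_pCons)

lemma const3_hom: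
  "const3 0 = 0" "const3 1 = 1" "const3 (a + b) = const3 a + const3 b"
  "const3 (a - b) = const3 a - const3 b" "const3 (a * b) = const3 a * const3 b"
  by (simp_all add: const3_def one_pCons)

lemma const3_of_nat: "const3 (of_nat n) = of_nat n"
  by (induction n) (simp_all add: const3_hom)

lemma const3_eq_0_iff [simp]: "const3 a = 0 \<longleftrightarrow> a = 0"
  by (simp add: const3_def)

lemma const3_inverse: "a \<noteq> 0 \<Longrightarrow> const3 a * const3 (inverse a) = 1"
  by (simp flip: const3_hom)

lemma is_unit_const3: "a \<noteq> 0 \<Longrightarrow> is_unit (const3 a)"
  by (rule dvdI[of _ _ "const3 (inverse a)"]) (simp add: const3_inverse)

lemma is_unit_of_nat3: "n > 0 \<Longrightarrow> is_unit (of_nat n :: poly3)"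
  using is_unit_const3[of "of_nat n"] by (simp add: const3_of_nat)

lemma XYZ_nonzero [simp]: "X \<noteq> 0" "Y \<noteq> 0" "Z \<noteq> 0"
  by (simp_all add: X_def Y_def Z_def)

lemma apply_deriv_linear_form:
  "apply_deriv (a, b, c) (const3 p * X + const3 q * Y) = const3 p * a + const3 q * b"
  by (simp add: apply_deriv_def px.add py.add pz.add px.mult py.mult pz.mult algebra_simps)

lemma apply_deriv_Z: "apply_deriv (a, b, c) Z = c"
  by (simp add: apply_deriv_def)

lemma apply_deriv_sub_scale:
  "apply_deriv (\<theta> - scale_deriv s \<eta>) f = apply_deriv \<theta> f - s * apply_deriv \<eta> f"
  by (auto simp: apply_deriv_def scale_deriv_def algebra_simps split: prod.split)

lemma apply_deriv_add_scale:
  "apply_deriv (scale_deriv s \<theta> + scale_deriv t \<eta>) f = s * apply_deriv \<theta> f + t * apply_deriv \<eta> f"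
  by (auto simp: apply_deriv_def scale_deriv_def algebra_simps split: prod.split)

subsection \<open>Coprimality and divisibility\<close>

lemma coprime_dvd_mult_cancel:
  "coprime a b \<Longrightarrow> a dvd b * c \<Longrightarrow> a dvd (c::'a::semiring_gcd)"
  by (simp add: coprime_dvd_mult_right_iff)

lemma prod_dvd_if_pairwise_coprime:
  fixes f :: "'i \<Rightarrow> 'a::semiring_gcd"
  assumes "finite A" "\<And>i j. i \<in> A \<Longrightarrow> j \<in> A \<Longrightarrow> i \<noteq> j \<Longrightarrow> coprime (f i) (f j)"
    and "\<And>i. i \<in> A \<Longrightarrow> f i dvd u"
  shows "prod f A dvd u"
  using assms
proof (induction A rule: finite_induct)
  case (insert a A)
  have "coprime (f a) (prod f A)"
    using insert by (intro prod_coprime_right) auto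
  with insert show ?case by (simp add: divides_mult)
qed simp

text \<open>The syzygies of a coprime pair are the multiples of the Koszul one: coprimality forces
  \<open>V\<close> to divide \<open>\<alpha>\<close>, and cancelling \<open>V\<close> then
  determines \<open>c\<close>.\<close>

lemma linear_relation_mod_solution:
  fixes U V :: "'a::{idom,semiring_gcd}"
  assumes "coprime V U" "V \<noteq> 0" "\<alpha> * U + c * V = 0"
  obtains t where "\<alpha> = t * V" "c = - t * U"
proof -
  have "U * \<alpha> = - c * V" using assms(3) by (simp add: algebra_simps eq_neg_iff_add_eq_0)
  then have "V dvd U * \<alpha>" by simp
  with assms(1) have "V dvd \<alpha>" by (rule coprime_dvd_mult_cancel)
  then obtain t where "\<alpha> = V * t" by blast
  then have t: "\<alpha> = t * V" by (simp add: mult.commute)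
  have "V * (c + t * U) = 0" using assms(3) by (simp add: t algebra_simps)
  with assms(2) have "c + t * U = 0" by (simp only: mult_eq_0_iff simp_thms)
  then have "c = - t * U" by (simp add: eq_neg_iff_add_eq_0)
  with t that show thesis by blast
qed

text \<open>Reduces coprimality to linear elimination: known coprime elements only have to be
  recovered from a common divisor of the new pair.\<close>

lemma coprime_transfer:
  assumes "coprime a b" "\<And>g. g dvd u \<Longrightarrow> g dvd v \<Longrightarrow> g dvd a \<and> g dvd b"
  shows "coprime u v"
  using assms by (auto simp: coprime_def)

lemma coprime_const_poly_monomial:
  fixes c :: "'a::idom_divide"
  assumes "c \<noteq> 0"
  shows "coprime [:c:] [:0, 1:]"
proof (rule coprimeI)
  fix g assume g: "g dvd [:c:]" "g dvd [:0, 1:]"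
  obtain u where "[:c:] = g * u" using g(1) by blast
  then have "degree g = 0"
    using assms by (metis add_is_0 degree_mult_eq degree_pCons_0 mult_eq_0_iff pCons_eq_0_iff)
  then obtain a where a: "g = [:a:]" by (metis degree_eq_zeroE)
  obtain h where "[:0, 1:] = g * h" using g(2) by blast
  \<comment> \<open>The divisor is a constant \<open>a\<close> that may divide the non-unit
    \<open>c\<close>; only the leading coefficient 1 of the monomial makes it a unit.\<close>
  then have "coeff [:0, 1:] 1 = a * coeff h 1" by (simp add: a)
  then have "1 = a * coeff h 1" by simp
  then have "1 = g * [:coeff h 1:]" by (simp add: a one_pCons mult.commute)
  then show "is_unit g" by (metis dvd_triv_left)
qed

text \<open>Lifts coprimality one layer up the tower: a common divisor has degree 0 because
  \<open>a\<close> is nonzero, so it already lives in the coefficient ring.\<close>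

lemma coprime_const_poly:
  fixes a b :: "'a::{idom_divide, algebraic_semidom}"
  assumes "coprime a b" "a \<noteq> 0"
  shows "coprime [:a:] [:b:]"
proof (rule coprimeI)
  fix g assume g: "g dvd [:a:]" "g dvd [:b:]"
  obtain u where "[:a:] = g * u" using g(1) by blast
  then have "degree g = 0"
    using assms by (metis add_is_0 degree_mult_eq degree_pCons_0 mult_eq_0_iff pCons_eq_0_iff)
  then obtain c where c: "g = [:c:]" by (metis degree_eq_zeroE)
  with g have "c dvd a" "c dvd b" by (auto simp: const_poly_dvd_const_poly_iff)
  with assms show "is_unit g" by (auto simp: c is_unit_const_poly_iff coprime_def)
qed

lemma coprime_X_Y: "coprime X Y"
  unfolding X_def Y_def
  by (intro coprime_const_poly coprime_const_poly_monomial) auto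

text \<open>The form does not involve \<open>z\<close>, so it is a nonzero constant of the outermost
  polynomial ring.\<close>

lemma coprime_linear_form_Z:
  assumes "linear_form_xy l"
  shows "coprime l Z"
proof -
  obtain a b where ab: "l = const3 a * X + const3 b * Y" "l \<noteq> 0"
    using assms by (auto simp: linear_form_xy_def)
  then have "l = [:[:[:0, a:], [:b:]:]:]"
    by (simp add: const3_def X_def Y_def)
  with ab(2) show ?thesis
    unfolding Z_def by (metis coprime_const_poly_monomial pCons_0_0)
qed

subsection \<open>Homogeneous polynomials\<close>

lemma homogeneous_zero [simp]: "homogeneous n 0"
  by (simp add: homogeneous_def)

lemma homogeneous_const3 [simp]: "homogeneous 0 (const3 c)"
  by (auto simp: homogeneous_def const3_def coeff_pCons split: nat.splits)

lemma homogeneous_of_nat [simp]: "homogeneous 0 (of_nat k)"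
  using homogeneous_const3[of "of_nat k"] by (simp only: const3_of_nat)

lemma homogeneous_one [simp]: "homogeneous 0 1"
  using homogeneous_of_nat[of 1] by simp

lemma homogeneous_XYZ [simp]: "homogeneous (Suc 0) X" "homogeneous (Suc 0) Y" "homogeneous (Suc 0) Z"
  by (auto simp: homogeneous_def X_def Y_def Z_def coeff_pCons split: nat.splits)

lemma homogeneous_add: "homogeneous n f \<Longrightarrow> homogeneous n g \<Longrightarrow> homogeneous n (f + g)"
  unfolding homogeneous_def by (metis add_0 coeff_add)

lemma homogeneous_uminus: "homogeneous n f \<Longrightarrow> homogeneous n (- f)"
  by (simp add: homogeneous_def)

lemma homogeneous_diff: "homogeneous n f \<Longrightarrow> homogeneous n g \<Longrightarrow> homogeneous n (f - g)"
  using homogeneous_add[of n f "- g"] by (simp add: homogeneous_uminus)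

lemma homogeneous_sum: "(\<And>i. i \<in> A \<Longrightarrow> homogeneous n (f i)) \<Longrightarrow> homogeneous n (\<Sum>i\<in>A. f i)"
  by (induction A rule: infinite_finite_induct) (auto simp: homogeneous_add)

text \<open>A nonzero coefficient of the product needs a nonzero term in the threefold convolution,
  and in that term the degrees add.\<close>

lemma homogeneous_mult:
  assumes f: "homogeneous n f" and g: "homogeneous r g"
  shows "homogeneous (n + r) (f * g)"
  unfolding homogeneous_def
proof (intro allI impI)
  fix i j k assume nz: "coeff (coeff (coeff (f * g) k) j) i \<noteq> 0"
  have "(\<Sum>c\<le>k. \<Sum>b\<le>j. \<Sum>a\<le>i. coeff (coeff (coeff f c) b) a *
      coeff (coeff (coeff g (k - c)) (j - b)) (i - a)) \<noteq> 0"
    using nz by (simp add: coeff_mult coeff_sum)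
  then obtain c b a where abc: "c \<le> k" "b \<le> j" "a \<le> i" "coeff (coeff (coeff f c) b) a *
      coeff (coeff (coeff g (k - c)) (j - b)) (i - a) \<noteq> 0"
    by (auto elim!: sum.not_neutral_contains_not_neutral)
  then have "a + b + c = n" "(i - a) + (j - b) + (k - c) = r"
    using f g unfolding homogeneous_def by (metis mult_eq_0_iff)+
  with abc(1-3) show "i + j + k = n + r" by linarith
qed

lemma homogeneous_scalar:
  "homogeneous n f \<Longrightarrow> homogeneous n (const3 c * f)"
  "homogeneous n f \<Longrightarrow> homogeneous n (of_nat k * f)"
  using homogeneous_mult[of 0 _ n f] by auto

lemma homogeneous_prod:
  "(\<And>i. i \<in> A \<Longrightarrow> homogeneous (n i) (f i)) \<Longrightarrow> homogeneous (\<Sum>i\<in>A. n i) (\<Prod>i\<in>A. f i)"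
  by (induction A rule: infinite_finite_induct) (auto simp: homogeneous_mult)

lemma homogeneous_power: "homogeneous n f \<Longrightarrow> homogeneous (k * n) (f ^ k)"
  by (induction k) (auto simp: homogeneous_mult)

lemma linear_form_homogeneous: "linear_form_xy l \<Longrightarrow> homogeneous 1 l"
    by (auto simp: linear_form_xy_def intro!: homogeneous_add homogeneous_scalar)

subsection \<open>A pencil with its lines\<close>

lemma homogeneous_basis_pair:
  assumes "homogeneous_deriv r \<theta>" "homogeneous_deriv s \<eta>"
    and "\<theta> \<in> D0 G" "\<eta> \<in> D0 G"
    and indep: "\<And>a b. scale_deriv a \<theta> + scale_deriv b \<eta> = 0 \<Longrightarrow> a = 0 \<and> b = 0"
    and span: "\<And>\<zeta>. \<zeta> \<in> D0 G \<Longrightarrow> \<exists>a b. \<zeta> = scale_deriv a \<theta> + scale_deriv b \<eta>"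
  shows "\<theta> \<noteq> \<eta> \<and> homogeneous_basis G {\<theta>, \<eta>}"
proof
  show neq: "\<theta> \<noteq> \<eta>"
  proof
    assume "\<theta> = \<eta>"
    then have "scale_deriv 1 \<theta> + scale_deriv (- 1) \<eta> = 0" by simp
    from indep[OF this] show False by simp
  qed
  have "derivations.independent {\<theta>, \<eta>}"
    using indep neq by (auto simp: derivations.dependent_finite)
  moreover have "derivations.span {\<theta>, \<eta>} = D0 G"
  proof (intro subset_antisym subsetI)
    fix \<zeta> assume "\<zeta> \<in> derivations.span {\<theta>, \<eta>}"
    then obtain a b where "\<zeta> - scale_deriv a \<theta> = scale_deriv b \<eta>"
      by (auto simp: derivations.span_insert derivations.span_singleton)
    then have "\<zeta> = scale_deriv a \<theta> + scale_deriv b \<eta>" by (simp add: algebra_simps)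
    with assms(3,4) show "\<zeta> \<in> D0 G" by (simp add: D0_iff apply_deriv_add_scale)
  next
    fix \<zeta> assume "\<zeta> \<in> D0 G"
    with span obtain a b where "\<zeta> = scale_deriv a \<theta> + scale_deriv b \<eta>" by blast
    then show "\<zeta> \<in> derivations.span {\<theta>, \<eta>}"
      by (simp add: derivations.span_add derivations.span_scale derivations.span_base)
  qed
  ultimately show "homogeneous_basis G {\<theta>, \<eta>}"
    using assms(1,2) by (auto simp: homogeneous_basis_def)
qed

lemma dvd_const3_mult_cancel: "c \<noteq> 0 \<Longrightarrow> g dvd const3 c * f \<Longrightarrow> g dvd f"
  using dvd_mult_unit_iff'[OF is_unit_const3] by blast

text \<open>
  The factor \<open>z^e\<close> with \<open>e \<le> 1\<close> treats both curves at once: \<open>G\<close> is \<open>F'\<close> for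
  \<open>e = 0\<close> and \<open>F''\<close> for \<open>e = 1\<close>.
\<close>

locale line_arrangement =
  fixes I :: "'i set" and p q :: "'i \<Rightarrow> complex" and k :: "'i \<Rightarrow> nat" and e :: nat
  assumes fin: "finite I" and two_lines: "card I \<ge> 2"
    and nondegenerate: "i \<in> I \<Longrightarrow> j \<in> I \<Longrightarrow> i \<noteq> j \<Longrightarrow> p i * q j - q i * p j \<noteq> 0"
    and k_pos: "i \<in> I \<Longrightarrow> k i \<ge> 1"
    and e_le: "e \<le> 1"
begin

definition "m = card I"
definition "d = (\<Sum>i\<in>I. k i)"
definition "l i = const3 (p i) * X + const3 (q i) * Y"
definition "P = (\<Prod>i\<in>I. l i ^ k i)"
definition "Q = (\<Prod>i\<in>I. l i)"
definition "F = P - Z ^ d"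
definition "G = Z ^ e * F * Q"

section \<open>Reducedness and degree of \<open>G\<close>\<close>

lemma form_nonzero:
  assumes "i \<in> I" shows "p i \<noteq> 0 \<or> q i \<noteq> 0"
proof -
  \<comment> \<open>A second line exists; its determinant with line \<open>i\<close> would vanish if
    both coefficients of \<open>l i\<close> were 0.\<close>
  have "\<not> I \<subseteq> {i}" using two_lines card_mono[of "{i}" I] by auto
  then obtain j where "j \<in> I" "i \<noteq> j" by blast
  with nondegenerate[OF assms this] show ?thesis by auto
qed

lemma d_ge_m: "d \<ge> m"
  unfolding d_def m_def using sum_mono[of I "\<lambda>_. 1" k] k_pos by simp

lemma m_ge_2: "m \<ge> 2" and d_ge_2: "d \<ge> 2"
  using d_ge_m two_lines by (auto simp: m_def)

lemma l_nonzero: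
  assumes "i \<in> I" shows "l i \<noteq> 0"
proof
  assume "l i = 0"
  then have "partial_x (l i) = 0" "partial_y (l i) = 0" by simp_all
  then show False
    using form_nonzero[OF assms] by (simp add: l_def px.add px.mult py.add py.mult)
qed

lemma linear_form_l: "i \<in> I \<Longrightarrow> linear_form_xy (l i)"
  using l_nonzero by (auto simp: linear_form_xy_def l_def)

text \<open>Cramer's rule: the determinant is a unit, so a common divisor of the two forms divides
  both variables.\<close>

lemma coprime_l:
  assumes ij: "i \<in> I" "j \<in> I" "i \<noteq> j" shows "coprime (l i) (l j)"
proof (rule coprime_transfer[OF coprime_X_Y])
  fix g assume g: "g dvd l i" "g dvd l j"
  let ?c = "p i * q j - q i * p j"
  have "const3 ?c * X = const3 (q j) * l i - const3 (q i) * l j"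
    "const3 ?c * Y = const3 (p i) * l j - const3 (p j) * l i"
    by (simp_all add: l_def const3_hom algebra_simps)
  with g have "g dvd const3 ?c * X" "g dvd const3 ?c * Y" by simp_all
  then show "g dvd X \<and> g dvd Y"
    using dvd_const3_mult_cancel[OF nondegenerate[OF ij]] by blast
qed

lemma coprime_P_Z: "coprime P Z"
  unfolding P_def
  by (intro prod_coprime_left) (simp add: coprime_linear_form_Z linear_form_l)

text \<open>Modulo \<open>l i\<close> the product \<open>P\<close> vanishes, so \<open>F\<close>
  reduces to \<open>- Z ^ d\<close>.\<close>

lemma coprime_l_F:
  assumes "i \<in> I" shows "coprime (l i) F"
proof (rule coprime_transfer)
  show "coprime (l i) (Z ^ d)"
    using coprime_linear_form_Z[OF linear_form_l[OF assms]] by simp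
  fix g assume g: "g dvd l i" "g dvd F"
  have "l i dvd l i ^ k i" using k_pos[OF assms] by (simp add: dvd_power)
  then have "l i dvd P" unfolding P_def using assms fin by (meson dvd_prodI dvd_trans)
  with g have "g dvd P - F" by (meson dvd_diff dvd_trans)
  with g show "g dvd l i \<and> g dvd Z ^ d" by (simp add: F_def)
qed

text \<open>A repeated factor divides both partials, which are the constants \<open>p i\<close> and
  \<open>q i\<close>, and one of these is a unit.\<close>

lemma squarefree_l:
  assumes "i \<in> I" shows "squarefree (l i)"
proof (rule squarefreeI)
  fix g assume g: "g\<^sup>2 dvd l i"
  have "g dvd const3 (p i) * 1" "g dvd const3 (q i) * 1"
    using px.square_dvd_imp_dvd[OF g] py.square_dvd_imp_dvd[OF g]
    by (simp_all add: l_def px.add px.mult py.add py.mult)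
  then show "g dvd 1" using form_nonzero[OF assms] dvd_const3_mult_cancel by blast
qed

lemma partial_z_P: "partial_z P = 0"
proof -
  have "partial_z (l i ^ n) = 0 * l i ^ n" for i n
    using pz.power_eigen[of "l i" 0 n] by (simp add: l_def pz.add pz.mult)
  then show ?thesis
    unfolding P_def using pz.prod_eigen[OF fin, of "\<lambda>i. l i ^ k i" "\<lambda>_. 0"] by simp
qed

lemma partial_z_Z_power: "partial_z (Z ^ n) = of_nat n * Z ^ (n - 1)"
  by (induction n) (auto simp: pz.mult algebra_simps power_eq_if)

text \<open>A repeated factor divides the \<open>z\<close>-derivative, hence a power of
  \<open>Z\<close>, hence also \<open>P = F + Z ^ d\<close>; but \<open>P\<close> and
  \<open>Z\<close> are coprime.\<close>

lemma squarefree_F: "squarefree F"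
proof (rule squarefreeI)
  fix g assume g: "g\<^sup>2 dvd F"
  have "g dvd partial_z F" using g by (rule pz.square_dvd_imp_dvd)
  then have "g dvd of_nat d * Z ^ (d - 1)"
    by (simp add: F_def pz.diff partial_z_P partial_z_Z_power)
  then have "g dvd Z ^ (d - 1)"
    using is_unit_of_nat3[of d] d_ge_2 by (simp add: dvd_mult_unit_iff')
  then have Z: "g dvd Z ^ d" by (meson dvd_trans diff_le_self le_imp_power_dvd)
  have "g dvd F" using g by (metis dvd_mult_left power2_eq_square)
  then have "g dvd F + Z ^ d" using Z by (rule dvd_add)
  then have "g dvd P" by (simp add: F_def)
  with Z show "g dvd 1"
    using coprime_P_Z by (meson coprime_common_divisor coprime_power_right_iff)
qed

lemma dvd_Z_power: "g dvd Z \<Longrightarrow> g dvd Z ^ d"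
  using d_ge_2 dvd_power[of d Z] by (auto intro: dvd_trans)

lemma coprime_Z_F: "coprime Z F"
proof (rule coprime_transfer[OF coprime_P_Z])
  fix g assume g: "g dvd Z" "g dvd F"
  then have "g dvd F + Z ^ d" by (simp add: dvd_Z_power)
  with g show "g dvd P \<and> g dvd Z" by (simp add: F_def)
qed

lemma squarefree_Z: "squarefree Z"
  using pz.square_dvd_imp_dvd[of _ Z] by (auto intro: squarefreeI)

lemma squarefree_G: "squarefree G"
proof -
  have "squarefree (Z ^ e)"
    using e_le squarefree_Z by (cases e) auto
  moreover have "squarefree Q"
    unfolding Q_def by (intro squarefree_prod_coprime squarefree_l coprime_l)
  moreover have "coprime (Z ^ e * F) Q"
    unfolding Q_def
    using coprime_linear_form_Z[OF linear_form_l] coprime_l_F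
    by (intro prod_coprime_right) (auto simp: coprime_commute)
  ultimately show ?thesis
    unfolding G_def using squarefree_F coprime_Z_F
    by (intro squarefree_mult_coprime) auto
qed

lemma homogeneous_l: "i \<in> I \<Longrightarrow> homogeneous 1 (l i)"
  by (rule linear_form_homogeneous[OF linear_form_l])

lemma homogeneous_prod_l: "A \<subseteq> I \<Longrightarrow> homogeneous (card A) (\<Prod>i\<in>A. l i)"
  using homogeneous_prod[of A "\<lambda>_. 1" l] homogeneous_l by auto

lemma homogeneous_P: "homogeneous d P"
  unfolding P_def d_def
  using homogeneous_power[OF homogeneous_l] by (intro homogeneous_prod) auto

lemma homogeneous_Z_power: "homogeneous n (Z ^ n)"
  using homogeneous_power[of "Suc 0" Z n] by simp

lemma homogeneous_G: "homogeneous (d + m + e) G"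
  using homogeneous_mult[OF homogeneous_mult[OF homogeneous_Z_power homogeneous_diff[OF
        homogeneous_P homogeneous_Z_power]] homogeneous_prod_l[OF subset_refl], of e]
  by (simp add: G_def F_def Q_def m_def ac_simps)

text \<open>Squarefreeness includes \<open>G \<noteq> 0\<close>, since every square divides
  0.\<close>

lemma reduced_G: "reduced_plane_curve (d + m + e) G"
  unfolding reduced_plane_curve_def
  using homogeneous_G squarefree_G m_ge_2 by auto

text \<open>
  \<open>\<theta>\<^sub>1\<close> multiplies each \<open>l j\<close> by \<open>d * \<gamma> j\<close> and \<open>z\<close> by \<open>h\<close>, hence \<open>P\<close> and \<open>z^d\<close> both by
  \<open>d * h\<close>, and \<open>G\<close> by \<open>\<Sum>j. w j * \<gamma> j\<close>. The weights \<open>w\<close> are read off from this; the sum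
  vanishes because the bracket \<open>br\<close> is antisymmetric.
\<close>

definition "br i j = const3 (p i * q j - q i * p j)"
definition "w i = of_nat (d + (d + e) * k i)"
definition "Q1 i = (\<Prod>j\<in>I - {i}. l j)"
definition "Q2 i j = (\<Prod>r\<in>I - {i, j}. l r)"
definition "\<delta>x = (\<Sum>i\<in>I. w i * const3 (q i) * Q1 i)"
definition "\<delta>y = - (\<Sum>i\<in>I. w i * const3 (p i) * Q1 i)"
definition "\<gamma> j = (\<Sum>i\<in>I. w i * br j i * Q2 i j)"
definition "h = (\<Sum>j\<in>I. of_nat (k j) * \<gamma> j)"
definition "\<theta>\<^sub>1 = (of_nat d * \<delta>x, of_nat d * \<delta>y, h * Z)"

text \<open>\<open>U = (x G\<^sub>x + y G\<^sub>y) / Q\<close> and \<open>V = G\<^sub>z / Q\<close>.\<close>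

definition "U = Z ^ e * (of_nat (d + m) * P - of_nat m * Z ^ d)"
definition "V = of_nat e * P - of_nat (d + e) * Z ^ (d + e - 1)"
definition "\<theta>\<^sub>2 = (V * X, V * Y, - U)"

section \<open>The first generator \<open>\<theta>\<^sub>1\<close>\<close>

lemma br_same [simp]: "br i i = 0"
  by (simp add: br_def)

lemma Q_split: "i \<in> I \<Longrightarrow> Q = l i * Q1 i"
  unfolding Q_def Q1_def using fin by (rule prod.remove)

lemma Q_nonzero: "Q \<noteq> 0"
  unfolding Q_def using fin l_nonzero by simp

lemma Q1_split: "i \<in> I \<Longrightarrow> j \<in> I \<Longrightarrow> i \<noteq> j \<Longrightarrow> Q1 i = l j * Q2 i j"
  using fin prod.remove[of "I - {i}" j l] Diff_insert2[of I i "{j}"]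
  by (simp add: Q1_def Q2_def)

text \<open>The Hamiltonian field of \<open>l i\<close> sends \<open>l j\<close> to
  \<open>br j i\<close>. This is 0 for \<open>i = j\<close>, and otherwise its coefficient
  \<open>Q1 i\<close> contains the factor \<open>l j\<close>, so every line is preserved.\<close>

lemma \<delta>_l:
  assumes j: "j \<in> I" shows "const3 (p j) * \<delta>x + const3 (q j) * \<delta>y = \<gamma> j * l j"
proof -
  have "const3 (p j) * \<delta>x + const3 (q j) * \<delta>y = (\<Sum>i\<in>I. w i * br j i * Q1 i)"
    by (simp add: \<delta>x_def \<delta>y_def br_def const3_hom sum_distrib_left sum_subtractf algebra_simps)
  also have "\<dots> = (\<Sum>i\<in>I. w i * br j i * Q2 i j * l j)"
  proof (intro sum.cong refl)
    fix i assume "i \<in> I"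
    with j show "w i * br j i * Q1 i = w i * br j i * Q2 i j * l j"
      by (cases "i = j") (simp_all add: Q1_split)
  qed
  finally show ?thesis by (simp add: \<gamma>_def sum_distrib_right)
qed

text \<open>Exchanging \<open>i\<close> and \<open>j\<close> fixes \<open>w j * w i\<close> and
  \<open>Q2 i j\<close> but flips the sign of \<open>br j i\<close>, so the double sum is its own
  negative.\<close>

lemma sum_w_\<gamma>: "(\<Sum>j\<in>I. w j * \<gamma> j) = 0"
proof -
  define S where "S = (\<Sum>j\<in>I. \<Sum>i\<in>I. w j * w i * br j i * Q2 i j)"
  have "S = (\<Sum>i\<in>I. \<Sum>j\<in>I. w j * w i * br j i * Q2 i j)"
    unfolding S_def by (rule sum.swap)
  also have "\<dots> = - S"
    by (simp add: S_def br_def Q2_def const3_hom insert_commute algebra_simps flip: sum_negf)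
  finally have "S = 0" by simp
  then show ?thesis by (simp add: S_def \<gamma>_def sum_distrib_left mult.assoc)
qed

lemma sum_w: "(\<Sum>i\<in>I. w i) = of_nat (d * (d + m + e))"
proof -
  have "(\<Sum>i\<in>I. d + (d + e) * k i) = d * (d + m + e)"
    unfolding sum.distrib sum_distrib_left[symmetric] d_def[symmetric]
    by (simp add: m_def algebra_simps)
  then show ?thesis unfolding w_def by (metis of_nat_sum)
qed

text \<open>In each term the coefficients of the Hamiltonian field recombine with \<open>X\<close>
  and \<open>Y\<close> to \<open>l i\<close>, and \<open>l i * Q1 i\<close> is \<open>Q\<close>;
  only the total weight remains.\<close>

lemma \<delta>_Euler: "X * \<delta>y - Y * \<delta>x = - of_nat (d * (d + m + e)) * Q"
proof -
  have "Y * \<delta>x - X * \<delta>y = (\<Sum>i\<in>I. w i * (l i * Q1 i))"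
    by (simp add: \<delta>x_def \<delta>y_def l_def sum_distrib_left sum.distrib algebra_simps)
  also have "\<dots> = of_nat (d * (d + m + e)) * Q"
    by (simp add: Q_split[symmetric] sum_distrib_right[symmetric] sum_w)
  finally show ?thesis by (simp add: algebra_simps)
qed

lemma apply_deriv_l:
  "apply_deriv (a, b, c) (l i) = const3 (p i) * a + const3 (q i) * b"
  by (simp add: l_def apply_deriv_linear_form)

lemma apply_deriv_P_Q:
  assumes "\<And>i. i \<in> I \<Longrightarrow> apply_deriv \<theta> (l i) = f i * l i"
  shows "apply_deriv \<theta> P = (\<Sum>i\<in>I. of_nat (k i) * f i) * P"
    and "apply_deriv \<theta> Q = (\<Sum>i\<in>I. f i) * Q"
  unfolding P_def Q_def using assms
  by (auto intro!: ad.prod_eigen[OF fin] ad.power_eigen)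

lemma \<theta>\<^sub>1_mem: "\<theta>\<^sub>1 \<in> D0 G"
proof -
  have l: "apply_deriv \<theta>\<^sub>1 (l i) = (of_nat d * \<gamma> i) * l i" if "i \<in> I" for i
  proof -
    have "apply_deriv \<theta>\<^sub>1 (l i) = of_nat d * (const3 (p i) * \<delta>x + const3 (q i) * \<delta>y)"
      by (simp add: \<theta>\<^sub>1_def apply_deriv_l algebra_simps)
    with \<delta>_l[OF that] show ?thesis by simp
  qed
  have P: "apply_deriv \<theta>\<^sub>1 P = of_nat d * h * P"
    using apply_deriv_P_Q(1)[OF l] by (simp add: h_def sum_distrib_left ac_simps)
  have Q: "apply_deriv \<theta>\<^sub>1 Q = of_nat d * (\<Sum>i\<in>I. \<gamma> i) * Q"
    using apply_deriv_P_Q(2)[OF l] by (simp add: sum_distrib_left)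
  have Z: "apply_deriv \<theta>\<^sub>1 (Z ^ n) = of_nat n * h * Z ^ n" for n
    by (rule ad.power_eigen) (simp add: \<theta>\<^sub>1_def apply_deriv_Z)
  have F: "apply_deriv \<theta>\<^sub>1 F = of_nat d * h * F"
    by (simp add: F_def ad.diff P Z algebra_simps)
  \<comment> \<open>The left side is the eigenvalue of \<open>G\<close>: \<open>e * h\<close> from
    \<open>Z ^ e\<close>, \<open>d * h\<close> from \<open>F\<close>, and the remaining sum from
    \<open>Q\<close>.\<close>
  have "of_nat (d + e) * h + of_nat d * (\<Sum>i\<in>I. \<gamma> i) = (\<Sum>i\<in>I. w i * \<gamma> i)"
    by (simp add: h_def w_def sum_distrib_left sum.distrib algebra_simps)
  then have 0: "of_nat (d + e) * h + of_nat d * (\<Sum>i\<in>I. \<gamma> i) = 0"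
    by (simp add: sum_w_\<gamma>)
  have "apply_deriv \<theta>\<^sub>1 G = (of_nat (d + e) * h + of_nat d * (\<Sum>i\<in>I. \<gamma> i)) * G"
    by (simp add: G_def ad.mult F Q Z algebra_simps)
  with 0 show ?thesis by (simp add: D0_iff)
qed

section \<open>The second generator \<open>\<theta>\<^sub>2\<close>\<close>

lemma partial_z_ZF: "partial_z (Z ^ e * F) = V"
proof -
  have F: "partial_z F = - of_nat d * Z ^ (d - 1)"
    by (simp add: F_def pz.diff partial_z_P partial_z_Z_power)
  show ?thesis
  proof (cases "e = 0")
    case True
    then show ?thesis unfolding V_def by (simp add: F)
  next
    case False
    with e_le have e: "e = 1" by simp
    have "Z ^ d = Z * Z ^ (d - 1)"
      using d_ge_2 by (cases d) simp_all
    then have "partial_z (Z * F) = P - of_nat (d + 1) * Z ^ d"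
      by (simp add: pz.mult F) (simp add: F_def algebra_simps)
    then show ?thesis unfolding V_def using e by simp
  qed
qed

text \<open>The Euler field in \<open>x\<close> and \<open>y\<close> alone scales \<open>P\<close>
  by \<open>d\<close>, scales \<open>Q\<close> by \<open>m\<close> and kills \<open>Z\<close>, while
  the \<open>z\<close>-part acts only on \<open>Z ^ e * F\<close>.\<close>

lemma apply_deriv_Euler_G:
  "apply_deriv (\<alpha> * X, \<alpha> * Y, c) G = (\<alpha> * U + c * V) * Q"
proof -
  define E where "E = (\<alpha> * X, \<alpha> * Y, 0 :: poly3)"
  have l: "apply_deriv E (l i) = \<alpha> * l i" for i
    by (simp add: apply_deriv_l E_def) (simp add: l_def algebra_simps)
  have P: "apply_deriv E P = of_nat d * \<alpha> * P"
    using apply_deriv_P_Q(1)[of E, OF l] by (simp add: d_def sum_distrib_right)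
  have Q: "apply_deriv E Q = of_nat m * \<alpha> * Q"
    using apply_deriv_P_Q(2)[of E, OF l] by (simp add: m_def)
  have Z: "apply_deriv E (Z ^ n) = 0" for n
    using ad.power_eigen[of E Z 0 n] by (simp add: apply_deriv_Z E_def)
  have zQ: "partial_z Q = 0"
    unfolding Q_def using pz.prod_eigen[OF fin, of l "\<lambda>_. 0"]
    by (simp add: l_def pz.add pz.mult)
  have "apply_deriv (\<alpha> * X, \<alpha> * Y, c) G = apply_deriv E G + c * partial_z G"
    by (simp add: apply_deriv_def E_def)
  also have "apply_deriv E G = \<alpha> * U * Q"
    by (simp add: G_def F_def U_def ad.mult ad.diff P Q Z algebra_simps)
  also have "partial_z G = V * Q"
    by (simp add: G_def pz.mult[of "Z ^ e * F"] partial_z_ZF zQ)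
  finally show ?thesis by (simp add: algebra_simps)
qed

lemma \<theta>\<^sub>2_mem: "\<theta>\<^sub>2 \<in> D0 G"
  by (simp add: D0_iff \<theta>\<^sub>2_def apply_deriv_Euler_G)

text \<open>For \<open>e = 0\<close>, \<open>V\<close> is a constant times
  \<open>Z ^ (d - 1)\<close>, and \<open>U\<close> is a nonzero multiple of \<open>P\<close> modulo
  \<open>Z\<close>. For \<open>e = 1\<close>, \<open>U\<close> is \<open>Z\<close> times a
  combination of \<open>P\<close> and \<open>Z ^ d\<close>, and the two factors are treated
  separately.\<close>

lemma coprime_V_U: "coprime V U"
proof (cases "e = 0")
  case True
  have "coprime Z (of_nat (d + m) * P - of_nat m * Z ^ d)"
  proof (rule coprime_transfer[OF coprime_P_Z])
    fix g assume g: "g dvd Z" "g dvd of_nat (d + m) * P - of_nat m * Z ^ d"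
    then have "g dvd (of_nat (d + m) * P - of_nat m * Z ^ d) + of_nat m * Z ^ d"
      by (intro dvd_add dvd_mult dvd_Z_power)
    then have "g dvd of_nat (d + m) * P" by simp
    with g show "g dvd P \<and> g dvd Z"
      using is_unit_of_nat3[of "d + m"] d_ge_2 by (simp add: dvd_mult_unit_iff' del: of_nat_add)
  qed
  moreover have "is_unit (of_nat d :: poly3)" using d_ge_2 by (intro is_unit_of_nat3) simp
  ultimately show ?thesis
    unfolding U_def V_def using True
    by (simp add: is_unit_left_imp_coprime del: of_nat_add)
next
  case False
  with e_le have e: "e = 1" by simp
  let ?B = "of_nat (d + m) * P - of_nat m * Z ^ d"
  have V: "V = P - of_nat (d + 1) * Z ^ d" unfolding V_def using e by simp
  have "coprime V Z"
  proof (rule coprime_transfer[OF coprime_P_Z])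
    fix g assume g: "g dvd V" "g dvd Z"
    then have "g dvd V + of_nat (d + 1) * Z ^ d"
      by (intro dvd_add dvd_mult dvd_Z_power)
    with g show "g dvd P \<and> g dvd Z" by (simp add: V)
  qed
  moreover have "coprime V ?B"
  proof (rule coprime_transfer)
    show "coprime P (Z ^ d)" using coprime_P_Z by simp
    fix g assume g: "g dvd V" "g dvd ?B"
    \<comment> \<open>Eliminates \<open>P\<close>; the resulting constant is the determinant of the
      two combinations of \<open>P\<close> and \<open>Z ^ d\<close>, and it is nonzero.\<close>
    have "of_nat (d * (d + m + 1)) * Z ^ d = ?B - of_nat (d + m) * V"
      by (simp add: V algebra_simps)
    then have "g dvd of_nat (d * (d + m + 1)) * Z ^ d" using g by simp
    then have Z: "g dvd Z ^ d"
      using is_unit_of_nat3[of "d * (d + m + 1)"] d_ge_2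
      by (simp add: dvd_mult_unit_iff' del: of_nat_add of_nat_mult)
    then have "g dvd V + of_nat (d + 1) * Z ^ d" using g by (intro dvd_add dvd_mult)
    with Z show "g dvd P \<and> g dvd Z ^ d" by (simp add: V)
  qed
  ultimately show ?thesis unfolding U_def using e by simp
qed

text \<open>The \<open>z\<close>-derivative removes \<open>P\<close> and leaves a power of
  \<open>Z\<close>, whose coefficient is nonzero because \<open>d \<ge> 2\<close>.\<close>

lemma V_nonzero: "V \<noteq> 0"
proof
  assume "V = 0"
  then have "partial_z V = 0" by simp
  moreover have "partial_z V = - of_nat (d + e) * (of_nat (d + e - 1) * Z ^ (d + e - 1 - 1))"
    by (simp only: V_def pz.diff pz.mult partial_z_P partial_z_Z_power flip: const3_of_nat)
      simp
  moreover have "of_nat (d + e) \<noteq> (0 :: poly3)" "of_nat (d + e - 1) \<noteq> (0 :: poly3)"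
    using d_ge_2 by (simp_all del: of_nat_add)
  ultimately show False by (simp del: of_nat_add)
qed

section \<open>Independence and generation\<close>

lemma independent:
  assumes "scale_deriv s \<theta>\<^sub>1 + scale_deriv t \<theta>\<^sub>2 = 0"
  shows "s = 0 \<and> t = 0"
proof -
  have x: "s * (of_nat d * \<delta>x) + t * (V * X) = 0" and y: "s * (of_nat d * \<delta>y) + t * (V * Y) = 0"
    using assms by (auto simp: scale_deriv_def \<theta>\<^sub>1_def \<theta>\<^sub>2_def zero_prod_def)
  \<comment> \<open>The pairing \<open>X * b - Y * a\<close> kills \<open>\<theta>\<^sub>2\<close>,
    which is radial in \<open>x\<close> and \<open>y\<close>, and sends
    \<open>\<theta>\<^sub>1\<close> to a nonzero multiple of \<open>Q\<close>.\<close>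
  have "s * of_nat d * (X * \<delta>y - Y * \<delta>x) =
      X * (s * (of_nat d * \<delta>y) + t * (V * Y)) - Y * (s * (of_nat d * \<delta>x) + t * (V * X))"
    by (simp add: algebra_simps)
  also have "\<dots> = 0" by (simp only: x y) simp
  finally have "s = 0" unfolding \<delta>_Euler using d_ge_2 Q_nonzero by simp (simp flip: of_nat_add of_nat_mult)
  with x V_nonzero show ?thesis by simp
qed

lemma spanning:
  assumes "\<zeta> \<in> D0 G"
  shows "\<exists>s t. \<zeta> = scale_deriv s \<theta>\<^sub>1 + scale_deriv t \<theta>\<^sub>2"
proof -
  obtain a b c where \<zeta>: "\<zeta> = (a, b, c)" by (cases \<zeta>)
  define u where "u = X * b - Y * a"
  have l_dvd: "l i dvd u" if i: "i \<in> I" for i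
  proof -
    let ?R = "Z ^ e * F * Q1 i"
    have "G = l i * ?R" using Q_split[OF i] by (simp add: G_def ac_simps)
    then have "apply_deriv \<zeta> (l i) * ?R + l i * apply_deriv \<zeta> ?R = 0"
      using assms by (simp add: D0_iff flip: ad.mult)
    then have "?R * apply_deriv \<zeta> (l i) = l i * (- apply_deriv \<zeta> ?R)"
      by (simp add: eq_neg_iff_add_eq_0 mult.commute)
    then have dvd: "l i dvd ?R * apply_deriv \<zeta> (l i)" by (metis dvd_triv_left)
    have "coprime (l i) (Q1 i)"
      unfolding Q1_def using i coprime_l by (intro prod_coprime_right) auto
    then have "coprime (l i) ?R"
      using coprime_l_F[OF i] coprime_linear_form_Z[OF linear_form_l[OF i]] by simp
    then have "l i dvd apply_deriv \<zeta> (l i)" using dvd by (rule coprime_dvd_mult_cancel)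
    then have A: "l i dvd const3 (p i) * a + const3 (q i) * b" by (simp add: \<zeta> apply_deriv_l)
    \<comment> \<open>Modulo \<open>l i\<close>, both \<open>p i * u\<close> and
      \<open>q i * u\<close> are multiples of the image of \<open>l i\<close> under
      \<open>\<zeta>\<close>; one of the two constants is a unit.\<close>
    have "const3 (p i) * u = b * l i - Y * (const3 (p i) * a + const3 (q i) * b)"
      "const3 (q i) * u = X * (const3 (p i) * a + const3 (q i) * b) - a * l i"
      by (simp_all add: u_def l_def algebra_simps)
    then have "l i dvd const3 (p i) * u" "l i dvd const3 (q i) * u"
      using A by (simp_all add: dvd_diff)
    then show ?thesis using form_nonzero[OF i] dvd_const3_mult_cancel by blast
  qed
  have "Q dvd u"
    unfolding Q_def using fin coprime_l l_dvd by (rule prod_dvd_if_pairwise_coprime)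
  then obtain v where v: "u = Q * v" by blast
  let ?N = "d * (d * (d + m + e))"
  have "is_unit (of_nat ?N :: poly3)"
    using d_ge_2 by (intro is_unit_of_nat3) simp
  then obtain \<kappa> :: poly3 where \<kappa>: "1 = of_nat ?N * \<kappa>" by blast
  \<comment> \<open>Chosen to cancel \<open>u\<close>: \<open>?N\<close> is the constant from
    \<open>\<delta>_Euler\<close> times the factor \<open>d\<close> in
    \<open>\<theta>\<^sub>1\<close>, and the sign is the one occurring there.\<close>
  define s where "s = - v * \<kappa>"
  define a' b' c' where "a' = a - s * (of_nat d * \<delta>x)" and "b' = b - s * (of_nat d * \<delta>y)"
    and "c' = c - s * (h * Z)"
  have \<zeta>': "\<zeta> - scale_deriv s \<theta>\<^sub>1 = (a', b', c')"
    by (simp add: \<zeta> scale_deriv_def \<theta>\<^sub>1_def a'_def b'_def c'_def)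
  have "X * b' - Y * a' = u - s * of_nat d * (X * \<delta>y - Y * \<delta>x)"
    by (simp add: a'_def b'_def u_def algebra_simps)
  also have "\<dots> = Q * v - Q * v * (of_nat ?N * \<kappa>)"
    by (simp add: \<delta>_Euler s_def v algebra_simps)
  also have "\<dots> = 0" using \<kappa> by simp
  finally have ab': "X * b' = Y * a'" by simp
  \<comment> \<open>A vanishing pairing makes \<open>(a', b')\<close> proportional to
    \<open>(X, Y)\<close>, with a polynomial factor because \<open>X\<close> and \<open>Y\<close>
    are coprime.\<close>
  then have "X dvd Y * a'" by (metis dvd_triv_left)
  with coprime_X_Y have "X dvd a'" by (rule coprime_dvd_mult_cancel)
  then obtain \<alpha> where "a' = X * \<alpha>" by blast
  then have \<alpha>: "a' = \<alpha> * X" by (simp add: mult.commute)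
  with ab' have "X * b' = X * (\<alpha> * Y)" by (simp add: ac_simps)
  then have b': "b' = \<alpha> * Y" by simp
  have "apply_deriv (a', b', c') G = 0"
    using assms \<theta>\<^sub>1_mem by (simp add: D0_iff apply_deriv_sub_scale flip: \<zeta>')
  then have "\<alpha> * U + c' * V = 0"
    using Q_nonzero by (simp add: \<alpha> b' apply_deriv_Euler_G)
  then obtain t where t: "\<alpha> = t * V" "c' = - t * U"
    using linear_relation_mod_solution coprime_V_U V_nonzero by metis
  have "\<zeta> - scale_deriv s \<theta>\<^sub>1 = scale_deriv t \<theta>\<^sub>2"
    unfolding \<zeta>' by (simp add: \<alpha> b' t scale_deriv_def \<theta>\<^sub>2_def)
  then show ?thesis by (metis add.commute diff_add_cancel)
qed

section \<open>Degrees of the two generators\<close>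

lemma homogeneous_w: "homogeneous n f \<Longrightarrow> homogeneous n (w i * f)"
  unfolding w_def by (rule homogeneous_scalar)

lemma homogeneous_Q1: "i \<in> I \<Longrightarrow> homogeneous (m - 1) (Q1 i)"
  using homogeneous_prod_l[of "I - {i}"] by (auto simp: Q1_def m_def)

text \<open>On the diagonal the bracket is 0, hence homogeneous of every degree, so
  \<open>m - 2\<close> serves for all terms of \<open>\<gamma> j\<close>.\<close>

lemma homogeneous_br_Q2:
  assumes "i \<in> I" "j \<in> I" shows "homogeneous (m - 2) (br j i * Q2 i j)"
proof (cases "i = j")
  case False
  then have "card (I - {i, j}) = m - 2" using assms fin by (simp add: card_Diff_subset m_def)
  then show ?thesis
    using homogeneous_prod_l[of "I - {i, j}"]
    by (auto simp: Q2_def br_def intro!: homogeneous_scalar)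
qed simp

lemma homogeneous_\<theta>\<^sub>1: "homogeneous_deriv (m - 1) \<theta>\<^sub>1"
proof -
  have "homogeneous (m - 1) \<delta>x" "homogeneous (m - 1) \<delta>y"
    unfolding \<delta>x_def \<delta>y_def mult.assoc
    by (intro homogeneous_uminus homogeneous_sum homogeneous_w homogeneous_scalar homogeneous_Q1; assumption)+
  moreover have "homogeneous (m - 2) h"
    unfolding h_def \<gamma>_def mult.assoc
    by (intro homogeneous_sum homogeneous_scalar homogeneous_w homogeneous_br_Q2)
  then have "homogeneous (m - 2 + 1) (h * Z)" by (rule homogeneous_mult) simp
  moreover have "m - 2 + 1 = m - 1" using m_ge_2 by simp
  ultimately show ?thesis
    by (simp add: homogeneous_deriv_def \<theta>\<^sub>1_def homogeneous_scalar)
qed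

lemma homogeneous_\<theta>\<^sub>2: "homogeneous_deriv (d + e) \<theta>\<^sub>2"
proof -
  have "homogeneous (d + e - 1) (of_nat e * P)"
  \<comment> \<open>\<open>P\<close> has degree \<open>d\<close>, which equals
    \<open>d + e - 1\<close> only for \<open>e = 1\<close>; for \<open>e = 0\<close> the term
    vanishes.\<close>
  proof (cases "e = 0")
    case False
    with e_le have "e = 1" by simp
    then show ?thesis using homogeneous_P by simp
  qed simp
  then have "homogeneous (d + e - 1) V"
    unfolding V_def
    by (rule homogeneous_diff[OF _ homogeneous_scalar(2)[OF homogeneous_Z_power]])
  then have "homogeneous (d + e - 1 + 1) (V * X)" "homogeneous (d + e - 1 + 1) (V * Y)"
    by (rule homogeneous_mult; simp)+
  moreover have "homogeneous (e + d) U"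
    unfolding U_def
    by (intro homogeneous_mult homogeneous_diff homogeneous_scalar homogeneous_Z_power homogeneous_P)
  ultimately show ?thesis
    using d_ge_2 by (simp add: homogeneous_deriv_def \<theta>\<^sub>2_def homogeneous_uminus add.commute)
qed

theorem free_with_exponents:
  "reduced_plane_curve (d + m + e) G \<and> free_curve G \<and> has_exponents G (m - 1) (d + e)"
proof -
  have "\<theta>\<^sub>1 \<noteq> \<theta>\<^sub>2 \<and> homogeneous_basis G {\<theta>\<^sub>1, \<theta>\<^sub>2}"
    using homogeneous_\<theta>\<^sub>1 homogeneous_\<theta>\<^sub>2 \<theta>\<^sub>1_mem \<theta>\<^sub>2_mem
    by (rule homogeneous_basis_pair) (fact independent, fact spanning)
  then have "free_curve G" "has_exponents G (m - 1) (d + e)"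
    unfolding free_curve_def has_exponents_def
    using reduced_G homogeneous_\<theta>\<^sub>1 homogeneous_\<theta>\<^sub>2 by (meson exI)+
  with reduced_G show ?thesis by simp
qed

end

section \<open>From the given linear forms to their coefficients\<close>

theorem theorem1p5:
  fixes m d :: nat and l :: "nat \<Rightarrow> poly3" and k :: "nat \<Rightarrow> nat" and F F' F'' :: poly3
  assumes "m \<ge> 2"
    and "\<And>j. j \<in> {1..m} \<Longrightarrow> linear_form_xy (l j)"
    and "\<And>i j. i \<in> {1..m} \<Longrightarrow> j \<in> {1..m} \<Longrightarrow> i \<noteq> j \<Longrightarrow> \<not> proportional (l i) (l j)"
    and "\<And>j. j \<in> {1..m} \<Longrightarrow> k j \<ge> 1"
    and "d = (\<Sum>j=1..m. k j)"
    and "F = (\<Prod>j=1..m. l j ^ k j) - Z ^ d"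
    and "F' = F * (\<Prod>j=1..m. l j)"
    and "F'' = Z * F * (\<Prod>j=1..m. l j)"
  shows "(reduced_plane_curve (d + m) F' \<and> free_curve F' \<and> has_exponents F' (m - 1) d) \<and>
         (reduced_plane_curve (d + m + 1) F'' \<and> free_curve F'' \<and> has_exponents F'' (m - 1) (d + 1))"
proof -
  have "\<forall>j\<in>{1..m}. \<exists>a b. l j = const3 a * X + const3 b * Y"
    using assms(2) unfolding linear_form_xy_def by blast
  then obtain p q where l: "\<And>j. j \<in> {1..m} \<Longrightarrow> l j = const3 (p j) * X + const3 (q j) * Y"
    by metis
  have nondegenerate: "p i * q j - q i * p j \<noteq> 0"
    if ij: "i \<in> {1..m}" "j \<in> {1..m}" "i \<noteq> j" for i j
  proof
    assume det: "p i * q j - q i * p j = 0"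
    have nz: "p r \<noteq> 0 \<or> q r \<noteq> 0" if "r \<in> {1..m}" for r
      using assms(2)[OF that] unfolding linear_form_xy_def l[OF that] by (auto simp: const3_hom)
    \<comment> \<open>The ratio of the two coefficient vectors; if \<open>p j = 0\<close>, then
      \<open>q j \<noteq> 0\<close> and the vanishing determinant gives \<open>p i = 0\<close>, so
      the second coordinates are compared.\<close>
    define c where "c = (if p j = 0 then q i / q j else p i / p j)"
    have "c \<noteq> 0" "p i = c * p j" "q i = c * q j"
      using nz[OF ij(1)] nz[OF ij(2)] det by (auto simp: c_def field_simps split: if_splits)
    then have "proportional (l i) (l j)"
      unfolding proportional_def l[OF ij(1)] l[OF ij(2)]
      by (intro exI[of _ c]) (simp add: const3_hom algebra_simps)
    with assms(3) ij show False by blast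
  qed
  have la: "line_arrangement {1..m} p q k e" if "e \<le> 1" for e
    by standard (use assms(1,4) that nondegenerate in auto)
  note defs = line_arrangement.G_def line_arrangement.F_def line_arrangement.P_def
    line_arrangement.Q_def line_arrangement.l_def line_arrangement.d_def line_arrangement.m_def
  \<comment> \<open>The chosen coefficients represent \<open>l j\<close> only for indices in
    \<open>{1..m}\<close>, so the identification is made inside the products.\<close>
  have prods: "(\<Prod>j=1..m. (const3 (p j) * X + const3 (q j) * Y) ^ k j) = (\<Prod>j=1..m. l j ^ k j)"
    "(\<Prod>j=1..m. const3 (p j) * X + const3 (q j) * Y) = (\<Prod>j=1..m. l j)"
    by (auto intro!: prod.cong simp: l)
  have G: "line_arrangement.G {1..m} p q k 0 = F'" "line_arrangement.G {1..m} p q k 1 = F''"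
    using la[of 0] la[of 1] by (simp_all add: defs prods assms(5-8) del: One_nat_def)
  have dm: "line_arrangement.d {1..m} k = d" "line_arrangement.m {1..m} = m"
    using la[of 0] by (simp_all add: defs assms(5) del: One_nat_def)
  show ?thesis
    using line_arrangement.free_with_exponents[OF la[of 0]]
      line_arrangement.free_with_exponents[OF la[of 1]]
    unfolding G dm by simp
qed

end
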